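(* Let $\nu_0=\sqrt{1-\sin^2 1}$ and $\nu_1=-\dfrac{\sin 2}{1+\cos 2}$. Let $\beta_1,\beta_2>0$ be real numbers with $\nu_0(\beta_1+\beta_2\nu_1)\geq \sinh 1$. Let $p$ be an analytic function in $\mathbb{D}$ with $p(0)=1$ and $$1+\beta_1 zp'(z)+\beta_2 z^2p''(z)\prec 1+\sin z.$$ Then $p(z)\prec 1+\sin z$.
   Context: $\mathbb{D}=\{z\in\mathbb{C}:|z|<1\}$. For functions $f,g$ analytic in $\mathbb{D}$, $f\prec g$ ($f$ is subordinate to $g$) means there is an analytic $w:\mathbb{D}\to\mathbb{C}$ with $w(0)=0$ and $|w(z)|\leq|z|$ such that $f(z)=g(w(z))$ for all $z\in\mathbb{D}$. Numerically $\nu_0\approx 0.540302$, $\nu_1\approx -1.55741$. *)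

theory Defs
  imports "HOL-Complex_Analysis.Complex_Analysis"
begin

abbreviation unit_disc :: "complex set"  (\<open>\<bbbD>\<close>)
  where "\<bbbD> \<equiv> ball 0 1"

text \<open>
  Subordination is meant for functions \<open>f\<close>, \<open>g\<close> that are analytic in the unit disc; this is
  not part of the definition. Values of \<open>f\<close> and \<open>g\<close> outside the disc are irrelevant, since
  \<open>norm (w z) \<le> norm z\<close>.
\<close>
definition subordinate :: "(complex \<Rightarrow> complex) \<Rightarrow> (complex \<Rightarrow> complex) \<Rightarrow> bool"
    (infix \<open>\<prec>\<close> 50)
  where "f \<prec> g \<longleftrightarrow>
    (\<exists>w. w analytic_on \<bbbD> \<and> w 0 = 0 \<and> (\<forall>z\<in>\<bbbD>. norm (w z) \<le> norm z) \<and>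
         (\<forall>z\<in>\<bbbD>. f z = g (w z)))"

definition nu0 :: real where "nu0 = sqrt (1 - (sin 1)\<^sup>2)"

definition nu1 :: real where "nu1 = - (sin 2 / (1 + cos 2))"

end

theory Submission
  imports Defs
begin

text \<open>
  Write \<open>g = deriv p\<close>. Since \<open>norm (sin w) \<le> norm w * sinh 1\<close> on the disc, the hypothesis bounds
  \<open>\<beta>1 * g + \<beta>2 * z * deriv g\<close> by \<open>sinh 1\<close>. Integrating along radii with the factor
  \<open>t powr (\<beta>1 / \<beta>2)\<close> yields \<open>norm g \<le> sinh 1 / \<beta>1\<close>. As \<open>nu0 = cos 1\<close> and \<open>nu1 < 0\<close>, this gives
  \<open>norm (p z - 1) \<le> norm z * cos 1\<close>. On the disc of radius \<open>cos 1\<close> the derivative of \<open>Arcsin\<close> is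
  at most \<open>1 / sin 1\<close>, and \<open>cos 1 \<le> sin 1\<close>, so \<open>Arcsin (p z - 1)\<close> is the required Schwarz function.
\<close>

text \<open>Only odd powers occur in the Taylor series, and each satisfies
  \<open>norm z ^ n \<le> norm z\<close> as \<open>n \<ge> 1\<close>. Factoring out
  \<open>norm z\<close> leaves the series of \<open>sinh\<close> at 1 as a majorant.\<close>

lemma norm_sin_le_sinh:
  fixes z :: complex
  assumes "norm z \<le> 1"
  shows "norm (sin z) \<le> norm z * sinh 1"
proof -
  let ?s = "\<lambda>n. norm z * (if even n then 0 else 1 ^ n /\<^sub>R fact n) :: real"
  have s: "?s sums (norm z * sinh 1)"
    by (intro sums_mult sinh_converges)
  have le: "norm (sin_coeff n *\<^sub>R z ^ n) \<le> ?s n" for n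
  proof (cases "even n")
    case False
    then obtain k where "n = Suc k"
      by (cases n) auto
    then have "norm z ^ n \<le> norm z * 1"
      using assms mult_left_le[OF power_le_one[of "norm z" k]] by simp
    with False show ?thesis
      by (simp add: sin_coeff_def norm_power abs_mult power_abs divide_simps)
  qed (simp add: sin_coeff_def)
  have "norm (\<Sum>n. sin_coeff n *\<^sub>R z ^ n) \<le> (\<Sum>n. ?s n)"
    using s le by (intro norm_suminf_le) (auto simp: sums_iff)
  with s show ?thesis
    by (simp add: sin_def sums_iff)
qed

lemma scaled_mem_ball:
  fixes z :: complex
  assumes "z \<in> ball 0 R" "0 \<le> t" "t \<le> 1"
  shows "of_real t * z \<in> ball 0 R"
proof -
  have "t * norm z \<le> norm z"
    using assms by (intro mult_left_le_one_le) auto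
  with assms show ?thesis
    by (simp add: norm_mult)
qed

lemma has_vector_derivative_along_ray:
  fixes f :: "complex \<Rightarrow> complex"
  assumes "f holomorphic_on ball 0 R" "of_real t * z \<in> ball 0 R"
  shows "((\<lambda>t. f (of_real t * z)) has_vector_derivative z * deriv f (of_real t * z)) (at t)"
proof -
  have "((\<lambda>t. of_real t * z) has_vector_derivative z) (at t)"
    unfolding has_vector_derivative_def
    by (auto intro!: derivative_eq_intros simp: scaleR_conv_of_real)
  moreover have "(f has_field_derivative deriv f (of_real t * z)) (at (of_real t * z))"
    using assms by (intro holomorphic_derivI[of f "ball 0 R"]) auto
  ultimately show ?thesis
    using field_vector_diff_chain_at[of "\<lambda>t. of_real t * z" z t f] by (simp add: o_def)
qed

text \<open>An integrating factor turns the operator into a derivative: along the ray,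
  \<open>t powr a * f (t * z)\<close> has derivative \<open>t powr (a - 1)\<close> times the
  operator at \<open>t * z\<close>. Its norm is at most the derivative of
  \<open>C * t powr a\<close>, so the increments over the unit interval compare. Positivity of
  \<open>a\<close> gives continuity at 0.\<close>

lemma norm_le_of_euler_operator_bound:
  fixes f :: "complex \<Rightarrow> complex" and a C :: real
  assumes holo: "f holomorphic_on ball 0 R" and "a > 0"
    and bound: "\<And>u. u \<in> ball 0 R - {0} \<Longrightarrow> norm (of_real a * f u + u * deriv f u) \<le> a * C"
    and z: "z \<in> ball 0 R - {0}"
  shows "norm (f z) \<le> C"
proof -
  have mem: "of_real t * z \<in> ball 0 R" if "0 \<le> t" "t \<le> 1" for t
    using z that by (intro scaled_mem_ball) auto
  let ?\<phi> = "\<lambda>t::real. t powr a *\<^sub>R f (of_real t * z)"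
  let ?\<phi>' = "\<lambda>t::real. t powr (a - 1) *\<^sub>R
    (of_real a * f (of_real t * z) + (of_real t * z) * deriv f (of_real t * z))"
  \<comment> \<open>Since \<open>0 powr a = 0\<close>, both terms at the left endpoint vanish and
    the inequality reads \<open>norm (f z) \<le> C\<close>.\<close>
  have "norm (?\<phi> 1 - ?\<phi> 0) \<le> C * 1 powr a - C * 0 powr a"
  proof (rule differentiable_bound_general[where f' = ?\<phi>' and \<phi>' = "\<lambda>t. C * (a * t powr (a - 1))"])
    show "continuous_on {0..1} ?\<phi>"
      using mem \<open>a > 0\<close>
      by (intro continuous_intros continuous_on_powr'
            continuous_on_compose2[OF holomorphic_on_imp_continuous_on[OF holo]]) auto
    show "continuous_on {0..1} (\<lambda>t. C * t powr a)"
      using \<open>a > 0\<close> by (intro continuous_intros continuous_on_powr') auto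
  next
    fix t :: real
    assume t: "0 < t" "t < 1"
    \<comment> \<open>The factor \<open>t\<close> split off here joins \<open>z\<close>, so that the
      product rule yields the operator at the point \<open>t * z\<close>.\<close>
    have tm: "t powr a = t powr (a - 1) * t"
      using t powr_mult_base[of t "a - 1"] by (simp add: mult.commute)
    have "((\<lambda>t. f (of_real t * z)) has_vector_derivative z * deriv f (of_real t * z)) (at t)"
      using mem[of t] t by (intro has_vector_derivative_along_ray[OF holo]) auto
    moreover have dp: "((\<lambda>t. t powr a) has_field_derivative a * t powr (a - 1)) (at t)"
      using t by (auto intro!: derivative_eq_intros)
    ultimately have "(?\<phi> has_vector_derivative t powr a *\<^sub>R (z * deriv f (of_real t * z))
        + (a * t powr (a - 1)) *\<^sub>R f (of_real t * z)) (at t)"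
      by (intro has_vector_derivative_scaleR) auto
    then show "(?\<phi> has_vector_derivative ?\<phi>' t) (at t)"
      by (simp add: tm scaleR_conv_of_real algebra_simps)
    show "((\<lambda>t. C * t powr a) has_vector_derivative C * (a * t powr (a - 1))) (at t)"
      using DERIV_cmult[OF dp] by (simp add: has_real_derivative_iff_has_vector_derivative)
    have "of_real t * z \<in> ball 0 R - {0}"
      using mem[of t] t z by auto
    from mult_left_mono[OF bound[OF this], of "t powr (a - 1)"]
    show "norm (?\<phi>' t) \<le> C * (a * t powr (a - 1))"
      by (simp only: norm_scaleR) (simp add: mult_ac)
  qed auto
  then show ?thesis
    by simp
qed

text \<open>Mean value inequality along the radius. The comparison takes derivatives for
  \<open>0 < t < 1\<close> only, where \<open>t * z\<close> is nonzero; this fits a bound obtained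
  by cancelling \<open>u\<close>.\<close>

lemma norm_diff_le_of_deriv_bound:
  fixes f :: "complex \<Rightarrow> complex"
  assumes holo: "f holomorphic_on ball 0 R"
    and bound: "\<And>u. u \<in> ball 0 R - {0} \<Longrightarrow> norm (deriv f u) \<le> C"
    and z: "z \<in> ball 0 R - {0}"
  shows "norm (f z - f 0) \<le> C * norm z"
proof -
  have mem: "of_real t * z \<in> ball 0 R" if "0 \<le> t" "t \<le> 1" for t
    using z that by (intro scaled_mem_ball) auto
  have "norm (f (of_real 1 * z) - f (of_real 0 * z)) \<le> C * norm z * 1 - C * norm z * 0"
  proof (rule differentiable_bound_general[where f = "\<lambda>t. f (of_real t * z)"
        and f' = "\<lambda>t. z * deriv f (of_real t * z)" and \<phi>' = "\<lambda>t. C * norm z"])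
    show "continuous_on {0..1} (\<lambda>t. f (of_real t * z))"
      using mem by (intro continuous_intros
          continuous_on_compose2[OF holomorphic_on_imp_continuous_on[OF holo]]) auto
  next
    fix t :: real
    assume t: "0 < t" "t < 1"
    show "((\<lambda>t. f (of_real t * z)) has_vector_derivative z * deriv f (of_real t * z)) (at t)"
      using mem[of t] t by (intro has_vector_derivative_along_ray[OF holo]) auto
    show "((\<lambda>t. C * norm z * t) has_vector_derivative C * norm z) (at t)"
      by (auto intro!: derivative_eq_intros)
    have "of_real t * z \<in> ball 0 R - {0}"
      using mem[of t] t z by auto
    from mult_left_mono[OF bound[OF this], of "norm z"]
    show "norm (z * deriv f (of_real t * z)) \<le> C * norm z"
      by (simp add: norm_mult mult.commute)
  qed (auto intro!: continuous_intros)
  then show ?thesis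
    by simp
qed

text \<open>The mean value inequality from 0 on a convex disc inside the strip where
  \<open>Arcsin\<close> is holomorphic. Its derivative is \<open>1 / cos (Arcsin v)\<close>, and the
  squared norm of that cosine is \<open>norm (1 - v^2)\<close>, at least
  \<open>1 - r^2\<close>.\<close>

lemma norm_Arcsin_le:
  assumes "norm u \<le> r" "r < 1"
  shows "norm (Arcsin u) \<le> norm u / sqrt (1 - r\<^sup>2)"
proof -
  have "0 \<le> r"
    using assms(1) norm_ge_zero order_trans by blast
  then have r2: "r\<^sup>2 < 1"
    using assms(2) by (simp add: power_less_one_iff)
  have dom: "\<bar>Re v\<bar> < 1" if "v \<in> cball 0 r" for v
    using abs_Re_le_cmod[of v] that assms(2) by auto
  have "norm (Arcsin u - Arcsin 0) \<le> 1 / sqrt (1 - r\<^sup>2) * norm (u - 0)"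
  proof (rule field_differentiable_bound[where S = "cball 0 r" and f' = "\<lambda>v. inverse (cos (Arcsin v))"])
    fix v :: complex
    assume v: "v \<in> cball 0 r"
    show "(Arcsin has_field_derivative inverse (cos (Arcsin v))) (at v within cball 0 r)"
      using has_field_derivative_Arcsin dom[OF v] has_field_derivative_at_within by blast
    have "(norm (cos (Arcsin v)))\<^sup>2 = norm (1 - v\<^sup>2)"
      by (simp add: cos_squared_eq flip: norm_power)
    also have "\<dots> \<ge> 1 - (norm v)\<^sup>2"
      using norm_triangle_ineq2[of 1 "v\<^sup>2"] by (simp add: norm_power)
    finally have "1 - r\<^sup>2 \<le> (norm (cos (Arcsin v)))\<^sup>2"
      using v power_mono[of "norm v" r 2] by simp
    then have "sqrt (1 - r\<^sup>2) \<le> norm (cos (Arcsin v))"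
      by (simp add: real_le_lsqrt)
    then show "norm (inverse (cos (Arcsin v))) \<le> 1 / sqrt (1 - r\<^sup>2)"
      using r2 by (simp add: norm_divide inverse_eq_divide frac_le)
  qed (use assms \<open>0 \<le> r\<close> in auto)
  then show ?thesis
    by simp
qed

text \<open>As \<open>pi < 4\<close>, the angle \<open>pi / 2 - 1\<close> is below 1, and cosine
  decreases on the interval from 0 to \<open>pi\<close>.\<close>

lemma cos_1_le_sin_1: "cos (1::real) \<le> sin 1"
proof -
  have "cos (1::real) \<le> cos (pi / 2 - 1)"
    using pi_less_4 pi_gt3 by (intro cos_monotone_0_pi_le) auto
  then show ?thesis
    by (simp add: cos_diff)
qed

lemma cos_1_pos: "cos (1::real) > 0"
  using pi_gt3 by (intro cos_gt_zero) auto

lemma sin_1_pos: "sin (1::real) > 0"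
  using pi_gt3 by (intro sin_gt_zero) auto

lemma nu0_eq_cos: "nu0 = cos 1"
  using cos_1_pos by (simp add: nu0_def flip: cos_squared_eq)

text \<open>By the half-angle formula \<open>nu1\<close> is \<open>- tan 1\<close>; the denominator
  is positive because \<open>1 + cos 2 = 2 * (cos 1)^2\<close>.\<close>

lemma nu1_neg: "nu1 < 0"
proof -
  have "sin (2::real) > 0"
    using pi_gt3 by (intro sin_gt_zero) auto
  moreover have "1 + cos (2::real) > 0"
    using cos_double_cos[of "1::real"] cos_1_pos by simp
  ultimately show ?thesis
    by (simp add: nu1_def)
qed

theorem theorem2p9:
  fixes \<beta>1 \<beta>2 :: real and p :: "complex \<Rightarrow> complex"
  assumes "\<beta>1 > 0" and "\<beta>2 > 0"
    and "nu0 * (\<beta>1 + \<beta>2 * nu1) \<ge> sinh 1"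
    and "p analytic_on \<bbbD>" and "p 0 = 1"
    and "(\<lambda>z. 1 + of_real \<beta>1 * z * deriv p z + of_real \<beta>2 * z\<^sup>2 * deriv (deriv p) z)
           \<prec> (\<lambda>z. 1 + sin z)"
  shows "p \<prec> (\<lambda>z. 1 + sin z)"
proof -
  have holo: "p holomorphic_on \<bbbD>" "deriv p holomorphic_on \<bbbD>"
    using assms(4) by (auto simp: analytic_on_open intro: holomorphic_deriv)
  obtain w where w: "\<And>z. z \<in> \<bbbD> \<Longrightarrow> norm (w z) \<le> norm z"
    and eq: "\<And>z. z \<in> \<bbbD> \<Longrightarrow>
      1 + of_real \<beta>1 * z * deriv p z + of_real \<beta>2 * z\<^sup>2 * deriv (deriv p) z = 1 + sin (w z)"
    using assms(6) unfolding subordinate_def by blast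
  \<comment> \<open>Discarding this nonpositive term from the assumed inequality keeps
    \<open>sinh 1\<close> as a lower bound.\<close>
  have "cos 1 * (\<beta>2 * nu1) \<le> 0"
    using cos_1_pos nu1_neg assms(2) by (simp add: mult_le_0_iff)
  then have "sinh 1 \<le> cos 1 * \<beta>1"
    using assms(3) by (simp add: nu0_eq_cos algebra_simps)
  then have quot: "sinh 1 / \<beta>1 \<le> cos 1"
    using assms(1) by (simp add: divide_simps)
  \<comment> \<open>Dividing the hypothesis by \<open>\<beta>2 * u\<close> leaves the Euler operator
    of \<open>deriv p\<close> with \<open>a = \<beta>1 / \<beta>2\<close>. The constant is written
    so that \<open>a * C = sinh 1 / \<beta>2\<close>.\<close>
  have "norm (of_real (\<beta>1 / \<beta>2) * deriv p u + u * deriv (deriv p) u) \<le> \<beta>1 / \<beta>2 * (sinh 1 / \<beta>1)"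
    if u: "u \<in> \<bbbD> - {0}" for u
  proof -
    let ?E = "of_real (\<beta>1 / \<beta>2) * deriv p u + u * deriv (deriv p) u"
    have "of_real \<beta>2 * ?E = of_real \<beta>1 * deriv p u + of_real \<beta>2 * (u * deriv (deriv p) u)"
      using assms(2) by (simp add: distrib_left)
    then have "of_real \<beta>2 * u * ?E =
        of_real \<beta>1 * u * deriv p u + of_real \<beta>2 * u\<^sup>2 * deriv (deriv p) u"
      by algebra
    then have "sin (w u) = of_real \<beta>2 * u * ?E"
      using eq[of u] u by (simp only: add.assoc add_left_cancel Diff_iff)
    then have "\<beta>2 * norm u * norm ?E = norm (sin (w u))"
      using assms(2) by (simp only: norm_mult norm_of_real)
    also have "\<dots> \<le> norm (w u) * sinh 1"
      using w[of u] u by (intro norm_sin_le_sinh) auto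
    also have "\<dots> \<le> norm u * sinh 1"
      using w[of u] u by (intro mult_right_mono) auto
    \<comment> \<open>The Schwarz bound on \<open>w\<close> supplies the factor
      \<open>norm u\<close> that cancels the one on the left.\<close>
    finally have "norm u * (\<beta>2 * norm ?E) \<le> norm u * sinh 1"
      by (simp add: mult_ac)
    then have "\<beta>2 * norm ?E \<le> sinh 1"
      using u by simp
    then show ?thesis
      using assms(1,2) by (simp add: pos_le_divide_eq mult.commute)
  qed
  then have "norm (deriv p u) \<le> sinh 1 / \<beta>1" if "u \<in> \<bbbD> - {0}" for u
    using that assms(1,2)
    by (intro norm_le_of_euler_operator_bound[OF holo(2), of "\<beta>1 / \<beta>2"]) (blast intro: divide_pos_pos)+
  then have "norm (p z - p 0) \<le> sinh 1 / \<beta>1 * norm z" if "z \<in> \<bbbD> - {0}" for z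
    using norm_diff_le_of_deriv_bound[OF holo(1) _ that] by blast
  then have p_bound: "norm (p z - 1) \<le> cos 1 * norm z" if "z \<in> \<bbbD>" for z
    using that quot mult_right_mono[OF quot norm_ge_zero[of z]] assms(5)
    by (cases "z = 0") (auto intro: order_trans)
  \<comment> \<open>Strictness keeps \<open>p z - 1\<close> in the strip where \<open>Arcsin\<close>
    is holomorphic and allows \<open>r = cos 1\<close> in the \<open>Arcsin\<close>
    estimate.\<close>
  have cos_less: "cos (1::real) < 1"
    using cos_1_le_sin_1 sin_1_pos cos_1_pos sin_cos_squared_add[of "1::real"]
    by (smt (verit) power2_eq_square mult_pos_pos one_power2 power_mono)
  have p_bound': "norm (p z - 1) \<le> cos 1" if "z \<in> \<bbbD>" for z
    using that cos_1_pos by (intro order_trans[OF p_bound[OF that] mult_left_le]) auto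
  show ?thesis
    unfolding subordinate_def
  \<comment> \<open>The witness solves \<open>p z = 1 + sin (w z)\<close> for \<open>w z\<close>;
    \<open>p 0 = 1\<close> makes it vanish at 0.\<close>
  proof (intro exI[of _ "\<lambda>z. Arcsin (p z - 1)"] conjI ballI)
    have "\<bar>Re (p z - 1)\<bar> < 1" if "z \<in> \<bbbD>" for z
      using p_bound'[OF that] cos_less abs_Re_le_cmod[of "p z - 1"] by linarith
    then have "(\<lambda>z. Arcsin (p z - 1)) holomorphic_on \<bbbD>"
      by (intro holomorphic_on_compose_gen[OF _ holomorphic_on_Arcsin[of "(\<lambda>z. p z - 1) ` \<bbbD>"],
            unfolded o_def] holomorphic_intros holo) auto
    then show "(\<lambda>z. Arcsin (p z - 1)) analytic_on \<bbbD>"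
      by (simp add: analytic_on_open)
  next
    fix z
    assume z: "z \<in> \<bbbD>"
    \<comment> \<open>With \<open>r = cos 1\<close> the denominator \<open>sqrt (1 - r^2)\<close> is
      \<open>sin 1\<close>; then \<open>cos 1 \<le> sin 1\<close> brings the quotient down to
      \<open>norm z\<close>.\<close>
    have "norm (Arcsin (p z - 1)) \<le> norm (p z - 1) / sin 1"
      using norm_Arcsin_le[OF p_bound'[OF z] cos_less] sin_1_pos
      by (simp flip: sin_squared_eq)
    also have "\<dots> \<le> sin 1 * norm z / sin 1"
      using p_bound[OF z] mult_right_mono[OF cos_1_le_sin_1 norm_ge_zero[of z]] sin_1_pos
      by (intro divide_right_mono) auto
    finally show "norm (Arcsin (p z - 1)) \<le> norm z"
      using sin_1_pos by simp
  qed (use assms(5) in auto)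
qed

end
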